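(* Let $x_1,x_2,x_3,x_4$ be prime numbers and let $a,b$ be positive integers such that (i) $x_1+x_2+x_3+x_4=a^2$; (ii) $\sum_{i=1}^{4}\mathrm{dgs}(x_i)=b^2$; (iii) $\mathrm{dgs}(a^2)+\mathrm{dgs}(b^2)=\mathrm{dgs}(a^2+b^2)$; (iv) $a^2+b^2$ is a prime of the form $4s+1$ for some positive integer $s$. Then $b\neq 4$.
   Context: For a positive integer $n$, $\mathrm{dgs}(n)$ denotes the sum of all digits of $n$ in its decimal representation. The primes $x_1,\dots,x_4$ need not be distinct. *)

theory Defs
  imports Complex_Main "HOL-Computational_Algebra.Primes"
begin

fun dgs :: "nat \<Rightarrow> nat" where
  "dgs n = (if n = 0 then 0 else n mod 10 + dgs (n div 10))"

declare dgs.simps [simp del]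

end

theory Submission
  imports Defs "HOL-Number_Theory.Cong"
begin

text \<open>
  Suppose \<open>b = 4\<close>. Since the digit sum is additive exactly when no carry occurs, (iii) forces the odd
  square \<open>a\<^sup>2\<close> to end in 1, so the units digits of the \<open>x\<^sub>i\<close>, whose sum lies between 4 and 16, add up
  to 11 and the remaining digits to 5. Hence \<open>a\<^sup>2\<close> has digit sum 7 with an even nonzero tens digit, and
  congruences modulo 8 and 11 leave only \<open>a\<^sup>2 = 121 + 10\<^sup>i + 10\<^sup>j + 10\<^sup>k\<close>.

  The exponents are then sieved: modulo a number \<open>p\<close> for which 10 has period dividing \<open>L\<close>, the equation
  depends only on \<open>i, j, k\<close> modulo \<open>L\<close>. Along \<open>L\<close> = 6, 30, 60, 420, 2100, 4200, 71400 this leaves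
  \<open>(i, j, k) \<equiv> (0, 2, -2)\<close> up to order. No congruence can remove this class, because
  \<open>121 + 1 + 10\<^sup>2 + 1/100 = 14.9\<^sup>2\<close>. But \<open>14.9\<^sup>2 + 16 = 238.01\<close>, and 10 has order 2975, a divisor of
  71400, modulo the prime 23801; so 23801 divides \<open>a\<^sup>2 + 16\<close>, which is therefore not prime.
\<close>

section \<open>Digit sums\<close>

lemma dgs_rec: "dgs n = n mod 10 + dgs (n div 10)"
  using dgs.simps[of n] by (cases "n = 0") auto

lemma dgs_0 [simp]: "dgs 0 = 0"
  by (simp add: dgs.simps)

lemma dgs_digit: "d < 10 \<Longrightarrow> dgs (10 * m + d) = dgs m + d"
  by (subst dgs_rec) simp

lemma digitE:
  fixes n :: nat
  obtains m d where "n = 10 * m + d" "d < 10" "n = 0 \<or> m < n"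
proof (rule that[of "n div 10" "n mod 10"])
  show "n = 10 * (n div 10) + n mod 10" by simp
  show "n mod 10 < 10" by simp
  show "n = 0 \<or> n div 10 < n" by (cases "n = 0") auto
qed

text \<open>A trailing 9 turns into 0 and passes the carry on to the shorter number; any other last
  digit just grows by 1.\<close>

lemma dgs_Suc_le: "dgs (Suc n) \<le> Suc (dgs n)"
proof (induction n rule: less_induct)
  case (less n)
  obtain m d where n: "n = 10 * m + d" "d < 10" "n = 0 \<or> m < n" by (rule digitE[of n])
  show ?case
  proof (cases "d = 9")
    case True
    then have "dgs (Suc m) \<le> Suc (dgs m)" using n by (intro less) simp
    moreover have "Suc n = 10 * Suc m + 0" using n True by simp
    then have "dgs (Suc n) = dgs (Suc m)" using dgs_digit[of 0 "Suc m"] by simp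
    moreover have "dgs n = dgs m + 9" unfolding n(1) True by (rule dgs_digit) simp
    ultimately show ?thesis by simp
  next
    case False
    then have "dgs (10 * m + Suc d) = dgs m + Suc d" using n(2) by (intro dgs_digit) simp
    then show ?thesis using dgs_digit[OF n(2), of m] by (simp add: n(1))
  qed
qed

text \<open>A carry out of the last digits takes 10 from the digit sum and, by
  \<open>dgs_Suc_le\<close>, gives back at most 1.\<close>

lemma dgs_add_le: "dgs (m + n) \<le> dgs m + dgs n"
proof (induction m arbitrary: n rule: less_induct)
  case (less m)
  show ?case
  proof (cases "m = 0")
    case False
    obtain m' d where m: "m = 10 * m' + d" "d < 10" "m = 0 \<or> m' < m" by (rule digitE[of m])
    obtain n' e where n: "n = 10 * n' + e" "e < 10" by (rule digitE[of n])
    have IH: "dgs (m' + n') \<le> dgs m' + dgs n'" using m False by (intro less) simp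
    have mn: "dgs m = dgs m' + d" "dgs n = dgs n' + e" using m n by (simp_all add: dgs_digit)
    show ?thesis
    proof (cases "d + e < 10")
      case True
      have "m + n = 10 * (m' + n') + (d + e)" using m n by simp
      then show ?thesis using IH mn dgs_digit[OF True, of "m' + n'"] by simp
    next
      case False
      then have "m + n = 10 * Suc (m' + n') + (d + e - 10)" "d + e - 10 < 10" using m n by simp_all
      then have "dgs (m + n) = dgs (Suc (m' + n')) + (d + e - 10)" by (simp only: dgs_digit)
      then show ?thesis using IH mn dgs_Suc_le[of "m' + n'"] False by simp
    qed
  qed simp
qed

lemma dgs_mod_9: "dgs n mod 9 = n mod 9"
proof (induction n rule: less_induct)
  case (less n)
  obtain m d where n: "n = 10 * m + d" "d < 10" "n = 0 \<or> m < n" by (rule digitE[of n])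
  show ?case
  proof (cases "n = 0")
    case False
    then have "dgs m mod 9 = m mod 9" using n by (intro less) simp
    moreover have "n = 9 * m + (m + d)" using n by simp
    ultimately show ?thesis using dgs_digit[OF n(2), of m] n(1)
      by (metis mod_add_left_eq mod_mult_self4)
  qed simp
qed

lemma dgs_eq_0_iff: "dgs n = 0 \<longleftrightarrow> n = 0"
proof (induction n rule: less_induct)
  case (less n)
  obtain m d where n: "n = 10 * m + d" "d < 10" "n = 0 \<or> m < n" by (rule digitE[of n])
  show ?case
  proof (cases "n = 0")
    case False
    then have "dgs m = 0 \<longleftrightarrow> m = 0" using n by (intro less) simp
    then show ?thesis using dgs_digit[OF n(2), of m] n(1) by simp
  qed simp
qed

text \<open>Lowering the last nonzero digit by 1 subtracts a power of 10. Iterated, this writes a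
  number of digit sum \<open>s\<close> as a sum of \<open>s\<close> powers of 10.\<close>

lemma dgs_SucE:
  assumes "dgs n = Suc s"
  obtains k m where "n = 10 ^ k + m" "dgs m = s"
  using assms
proof (induction n arbitrary: thesis rule: less_induct)
  case (less n)
  obtain m d where n: "n = 10 * m + d" "d < 10" "n = 0 \<or> m < n" by (rule digitE[of n])
  have dgs_n: "dgs n = dgs m + d" using n by (simp add: dgs_digit)
  show ?case
  proof (cases d)
    case 0
    have "n \<noteq> 0" using less.prems(2) by (intro notI) simp
    then obtain k l where kl: "m = 10 ^ k + l" "dgs l = s"
      using less.IH[of m] n(3) less.prems(2) dgs_n 0 by auto
    show ?thesis
    proof (rule less.prems(1))
      show "n = 10 ^ Suc k + 10 * l" using n(1) kl(1) 0 by simp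
      show "dgs (10 * l) = s" using dgs_digit[of 0 l] kl(2) by simp
    qed
  next
    case (Suc e)
    show ?thesis
    proof (rule less.prems(1))
      show "n = 10 ^ 0 + (10 * m + e)" using n(1) Suc by simp
      show "dgs (10 * m + e) = s" using dgs_digit[of e m] n(2) dgs_n less.prems(2) Suc by simp
    qed
  qed
qed

section \<open>Squares modulo 8 and modulo 11\<close>

lemma power_10_mod_11: "10 ^ k mod 11 = (1::nat) \<or> 10 ^ k mod 11 = (10::nat)"
proof (induction k)
  case (Suc k)
  have "10 ^ Suc k mod 11 = 10 * (10 ^ k mod 11) mod (11::nat)" by (simp add: mod_mult_right_eq)
  with Suc show ?case by auto
qed simp

lemma square_mod_11: "(a::nat)\<^sup>2 mod 11 \<in> {0, 1, 3, 4, 5, 9}"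
proof -
  have "a mod 11 \<in> set [0..<11]" by simp
  moreover have "a\<^sup>2 mod 11 = (a mod 11)\<^sup>2 mod 11" by (simp add: power_mod)
  moreover have "\<forall>x \<in> set [0..<11]. x\<^sup>2 mod 11 \<in> {0, 1, 3, 4, 5, 9::nat}" by code_simp
  ultimately show ?thesis by simp
qed

text \<open>As 10 is -1 modulo 11, the right-hand side leaves 6, 8 or 10, and these are not squares
  modulo 11.\<close>

lemma square_ne_41_plus_two_powers: "(a::nat)\<^sup>2 \<noteq> 41 + 10 ^ i + 10 ^ j"
proof
  assume eq: "a\<^sup>2 = 41 + 10 ^ i + 10 ^ j"
  define u v where "u = (10::nat) ^ i mod 11" and "v = (10::nat) ^ j mod 11"
  have "a\<^sup>2 mod 11 = (41 + u + v) mod 11"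
    unfolding eq u_def v_def by (intro mod_add_cong) simp_all
  moreover have "u = 1 \<or> u = 10" "v = 1 \<or> v = 10"
    unfolding u_def v_def by (rule power_10_mod_11)+
  ultimately show False
    using square_mod_11[of a] by auto
qed

lemma square_mod_8: "odd (a::nat) \<Longrightarrow> a\<^sup>2 mod 8 = 1"
proof -
  assume "odd a"
  then have "a mod 8 \<in> {1, 3, 5, 7}" by simp presburger
  moreover have "a\<^sup>2 mod 8 = (a mod 8)\<^sup>2 mod 8" by (simp add: power_mod)
  ultimately show ?thesis by auto
qed

text \<open>The digits of the square are those of \<open>h\<close>, then \<open>T\<close>, then 1.
  The digit sum leaves 6 for \<open>h\<close> and \<open>T\<close> together; modulo 8,
  \<open>T\<close> is even, and modulo 11 only \<open>T = 2\<close> survives.\<close>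

lemma square_digit_sum_7_cases:
  fixes a :: nat
  assumes "odd a" and sq: "a\<^sup>2 = 10 * m + 11" and "dgs m \<le> 5" and mod9: "a\<^sup>2 mod 9 = 7"
  obtains i j k where "a\<^sup>2 = 121 + 10 ^ i + 10 ^ j + 10 ^ k"
proof -
  define h where "h = (m + 1) div 10"
  define T where "T = (m + 1) mod 10"
  have M: "m + 1 = 10 * h + T" and T10: "T < 10" by (simp_all add: h_def T_def)
  \<comment> \<open>Otherwise \<open>m\<close> ends in 9, against
    \<open>dgs m \<le> 5\<close>.\<close>
  have T: "T \<noteq> 0"
  proof
    assume "T = 0"
    then have "m = 10 * (h - 1) + 9" using M by (cases h) auto
    then have "dgs m = dgs (h - 1) + 9" using dgs_digit[of 9 "h - 1"] by simp
    then show False using assms(3) by simp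
  qed
  \<comment> \<open>Modulo 9, \<open>dgs (m + 1)\<close> is congruent to 6, and its upper bound is 6
    as well.\<close>
  have "(10 * m + 11) mod 9 = 7" using mod9 unfolding sq .
  moreover have "10 * m + 11 = (m + 1) + 1 + (m + 1) * 9" by simp
  ultimately have "((m + 1) + 1) mod 9 = 7" by (simp only: mod_mult_self1)
  moreover have "(dgs (m + 1) + 1) mod 9 = ((m + 1) + 1) mod 9"
    by (intro mod_add_cong dgs_mod_9 refl)
  ultimately have "(dgs (m + 1) + 1) mod 9 = 7" by (rule trans[rotated])
  moreover have "dgs (m + 1) \<le> 6" using dgs_Suc_le[of m] assms(3) by simp
  ultimately have "dgs (m + 1) = 6" by simp
  then have hT: "dgs h + T = 6" unfolding M dgs_digit[OF T10] .
  have sq': "a\<^sup>2 = 100 * h + 10 * T + 1" using sq M by simp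
  have mod8: "a\<^sup>2 mod 8 = 1" by (rule square_mod_8) fact
  then have "(100 * h + 10 * T + 1) mod 8 = 1" unfolding sq' .
  then have "100 * h + 10 * T + 1 = 8 * ((100 * h + 10 * T + 1) div 8) + 1"
    by (metis mult_div_mod_eq)
  then obtain q where "100 * h + 10 * T + 1 = 8 * q + 1" by blast
  then have q: "50 * h + 5 * T = 4 * q" by simp
  have "even (50 * h + 5 * T)" unfolding q by simp
  then have "even T" by simp
  moreover have "T \<le> 6" using hT by simp
  ultimately have "T \<in> {2, 4, 6}" using T by simp presburger
  then consider "T = 2" "dgs h = 4" | "T = 4" "dgs h = 2" | "T = 6" "dgs h = 0"
    using hT by auto
  then show thesis
  proof cases
    case 1
    then have "25 * h + 5 = 2 * q" using q by simp
    then have "even (25 * h + 5)" by simp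
    then have "odd h" by simp
    \<comment> \<open>As \<open>h\<close> is odd, its last digit is nonzero and 1 can be taken off
      without a borrow; the remaining digit sum 3 splits into three powers of 10.\<close>
    obtain h' e where h: "h = 10 * h' + e" "e < 10" by (rule digitE[of h])
    with \<open>odd h\<close> have "e \<noteq> 0" by (intro notI) simp
    then have "dgs (10 * h' + (e - 1)) = dgs h' + (e - 1)" using h by (intro dgs_digit) simp
    moreover have "h - 1 = 10 * h' + (e - 1)" using h \<open>e \<noteq> 0\<close> by simp
    ultimately have "dgs (h - 1) = Suc 2"
      using 1 h \<open>e \<noteq> 0\<close> dgs_digit[OF h(2), of h'] by simp
    then obtain i m1 where "h - 1 = 10 ^ i + m1" "dgs m1 = 2" by (rule dgs_SucE)
    moreover from this obtain j m2 where "m1 = 10 ^ j + m2" "dgs m2 = 1"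
      using dgs_SucE[of m1 1] by auto
    moreover from this obtain k m3 where "m2 = 10 ^ k + m3" "dgs m3 = 0"
      using dgs_SucE[of m2 0] by auto
    ultimately have "h = 1 + (10 ^ i + (10 ^ j + 10 ^ k))"
      using \<open>odd h\<close> by (cases h) (auto simp: dgs_eq_0_iff)
    \<comment> \<open>\<open>h\<close> counts hundreds, which shifts the exponents by 2, and 121 is
      \<open>100 * 1 + 10 * T + 1\<close>.\<close>
    then have "a\<^sup>2 = 121 + 10 ^ (i + 2) + 10 ^ (j + 2) + 10 ^ (k + 2)"
      unfolding sq' 1 by (simp add: power_add)
    then show thesis by (rule that)
  next
    case 2
    then obtain i m1 where "h = 10 ^ i + m1" "dgs m1 = 1"
      using dgs_SucE[of h 1] by auto
    moreover from this obtain j m2 where "m1 = 10 ^ j + m2" "dgs m2 = 0"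
      using dgs_SucE[of m1 0] by auto
    ultimately have "h = 10 ^ i + 10 ^ j" by (simp add: dgs_eq_0_iff)
    then have "a\<^sup>2 = 41 + 10 ^ (i + 2) + 10 ^ (j + 2)"
      unfolding sq' 2 by (simp add: power_add)
    then show thesis using square_ne_41_plus_two_powers by blast
  next
    case 3
    then have "a\<^sup>2 = 61" using sq' by (simp add: dgs_eq_0_iff)
    then have "a\<^sup>2 mod 11 = 6" by simp
    then show thesis using square_mod_11[of a] by simp
  qed
qed

section \<open>Sieving the exponents\<close>

text \<open>
  The sieve is evaluated by rewriting. Residues are of type \<^typ>\<open>num\<close>, on which rewriting is cheap;
  as this type has no zero, residue classes modulo \<open>p\<close> are represented by \<open>1, \<dots>, p\<close>. A trie indexed by
  the binary digits holds the squares modulo \<open>p\<close>.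
\<close>

datatype trie = Tip | Node bool trie trie

fun trie_insert :: "num \<Rightarrow> trie \<Rightarrow> trie" where
  "trie_insert num.One Tip = Node True Tip Tip"
| "trie_insert (num.Bit0 n) Tip = Node False (trie_insert n Tip) Tip"
| "trie_insert (num.Bit1 n) Tip = Node False Tip (trie_insert n Tip)"
| "trie_insert num.One (Node b l r) = Node True l r"
| "trie_insert (num.Bit0 n) (Node b l r) = Node b (trie_insert n l) r"
| "trie_insert (num.Bit1 n) (Node b l r) = Node b l (trie_insert n r)"

fun trie_member :: "num \<Rightarrow> trie \<Rightarrow> bool" where
  "trie_member n Tip = False"
| "trie_member num.One (Node b l r) = b"
| "trie_member (num.Bit0 n) (Node b l r) = trie_member n l"
| "trie_member (num.Bit1 n) (Node b l r) = trie_member n r"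

lemma trie_member_insert_same: "trie_member n (trie_insert n T)"
  by (induction n T rule: trie_insert.induct) auto

lemma trie_member_insert: "trie_member k T \<Longrightarrow> trie_member k (trie_insert n T)"
proof (induction n T arbitrary: k rule: trie_insert.induct)
  case (4 b l r k) then show ?case by (cases k) auto
next
  case (5 n b l r k) then show ?case by (cases k) auto
next
  case (6 n b l r k) then show ?case by (cases k) auto
qed auto

section \<open>Residue arithmetic on binary numerals\<close>

fun num_diff :: "num \<Rightarrow> num \<Rightarrow> num" where
  "num_diff num.One n = num.One"
| "num_diff (num.Bit0 m) num.One = Num.BitM m"
| "num_diff (num.Bit1 m) num.One = num.Bit0 m"
| "num_diff (num.Bit0 m) (num.Bit0 n) = num.Bit0 (num_diff m n)"
| "num_diff (num.Bit0 m) (num.Bit1 n) = Num.BitM (num_diff m n)"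
| "num_diff (num.Bit1 m) (num.Bit0 n) = (if m = n then num.One else num.Bit1 (num_diff m n))"
| "num_diff (num.Bit1 m) (num.Bit1 n) = num.Bit0 (num_diff m n)"

lemma nat_of_num_BitM: "nat_of_num (Num.BitM n) = 2 * nat_of_num n - 1"
proof (induction n)
  case (Bit0 n)
  then show ?case using nat_of_num_pos[of n] by simp
qed auto

text \<open>The test \<open>m = n\<close> in the odd-minus-even clause catches the difference 1,
  where the recursive difference would be 0. The first clause of \<open>num_diff\<close> is a
  default value.\<close>

lemma nat_of_num_diff:
  "nat_of_num n < nat_of_num m \<Longrightarrow> nat_of_num (num_diff m n) = nat_of_num m - nat_of_num n"
proof (induction m n rule: num_diff.induct)
  case (1 n) then show ?case using nat_of_num_pos[of n] by simp
next
  case (6 m n)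
  then show ?case by (cases "m = n") (auto simp: num_eq_iff)
qed (auto simp: nat_of_num_BitM)

definition represents :: "num \<Rightarrow> num \<Rightarrow> nat \<Rightarrow> bool" where
  "represents p x n \<longleftrightarrow> nat_of_num x \<le> nat_of_num p \<and> [nat_of_num x = n] (mod nat_of_num p)"

text \<open>Subtracting 1 moves the representatives from 1, ..., p to 0, ..., p - 1, where congruent
  numbers are equal.\<close>

lemma represents_unique:
  assumes "represents p x n" "represents p y n"
  shows "x = y"
proof -
  have *: "[nat_of_num x = nat_of_num y] (mod nat_of_num p)"
    using assms unfolding represents_def by (meson cong_sym cong_trans)
  have "[int (nat_of_num x - 1) = int (nat_of_num y - 1)] (mod int (nat_of_num p))"
    using * nat_of_num_pos[of x] nat_of_num_pos[of y]
    by (simp add: of_nat_diff cong_diff cong_int_iff Suc_leI)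
  then have "nat_of_num x - 1 = nat_of_num y - 1"
    unfolding cong_int_iff
    by (rule cong_less_modulus_unique_nat)
       (use assms nat_of_num_pos[of x] nat_of_num_pos[of y] in \<open>auto simp: represents_def\<close>)
  then have "nat_of_num x = nat_of_num y"
    using nat_of_num_pos[of x] nat_of_num_pos[of y] by linarith
  then show ?thesis by (simp add: num_eq_iff)
qed

lemma represents_One: "represents p num.One 1"
  using nat_of_num_pos[of p] by (simp add: represents_def)

lemma represents_cong: "represents p x m \<Longrightarrow> [m = n] (mod nat_of_num p) \<Longrightarrow> represents p x n"
  unfolding represents_def by (auto intro: cong_trans)

text \<open>For summands of at most \<open>p\<close>, one subtraction suffices. The strict
  comparison keeps \<open>p\<close> itself as representative of the class of 0.\<close>

definition add_mod :: "num \<Rightarrow> num \<Rightarrow> num \<Rightarrow> num" where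
  "add_mod p x y = (if p < x + y then num_diff (x + y) p else x + y)"

lemma represents_add_mod:
  assumes "represents p x m" "represents p y n"
  shows "represents p (add_mod p x y) (m + n)"
proof -
  have c: "[nat_of_num x + nat_of_num y = m + n] (mod nat_of_num p)"
    using assms unfolding represents_def by (auto intro: cong_add)
  show ?thesis
  proof (cases "p < x + y")
    case True
    then have lt: "nat_of_num p < nat_of_num x + nat_of_num y"
      by (simp add: less_num_def nat_of_num_add)
    then have "nat_of_num (add_mod p x y) = nat_of_num x + nat_of_num y - nat_of_num p"
      using True by (simp add: add_mod_def nat_of_num_diff nat_of_num_add)
    moreover have "[nat_of_num x + nat_of_num y - nat_of_num p = nat_of_num x + nat_of_num y] (mod nat_of_num p)"
      using lt by (simp add: cong_def le_mod_geq)
    ultimately show ?thesis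
      using assms c lt unfolding represents_def by (auto intro: cong_trans)
  next
    case False
    then show ?thesis using c
      by (simp add: represents_def add_mod_def nat_of_num_add less_num_def)
  qed
qed

text \<open>Double and add along the binary digits of the last argument, which may exceed
  \<open>p\<close>; multiplying \<open>num.One\<close> by a constant thus reduces it modulo
  \<open>p\<close>.\<close>

fun mult_mod :: "num \<Rightarrow> num \<Rightarrow> num \<Rightarrow> num" where
  "mult_mod p x num.One = x"
| "mult_mod p x (num.Bit0 n) = mult_mod p (add_mod p x x) n"
| "mult_mod p x (num.Bit1 n) = add_mod p x (mult_mod p (add_mod p x x) n)"

lemma represents_mult_num:
  "represents p x m \<Longrightarrow> represents p (mult_mod p x y) (m * nat_of_num y)"
proof (induction p x y arbitrary: m rule: mult_mod.induct)
  case (2 p x n)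
  have "represents p (mult_mod p (add_mod p x x) n) ((m + m) * nat_of_num n)"
    by (rule 2) (use 2 in \<open>simp add: represents_add_mod\<close>)
  then show ?case by (simp add: algebra_simps)
next
  case (3 p x n)
  have "represents p (mult_mod p (add_mod p x x) n) ((m + m) * nat_of_num n)"
    by (rule 3) (use 3 in \<open>simp add: represents_add_mod\<close>)
  from represents_add_mod[OF 3(2) this] show ?case by (simp add: algebra_simps)
qed auto

lemma represents_mult_mod:
  assumes "represents p x m" "represents p y n"
  shows "represents p (mult_mod p x y) (m * n)"
  using represents_mult_num[OF assms(1), of y]
  by (rule represents_cong) (use assms(2) in \<open>auto simp: represents_def intro: cong_mult\<close>)

fun pow_mod :: "num \<Rightarrow> num \<Rightarrow> num \<Rightarrow> num" where
  "pow_mod p x num.One = x"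
| "pow_mod p x (num.Bit0 n) = pow_mod p (mult_mod p x x) n"
| "pow_mod p x (num.Bit1 n) = mult_mod p x (pow_mod p (mult_mod p x x) n)"

lemma represents_pow_mod:
  "represents p x m \<Longrightarrow> represents p (pow_mod p x e) (m ^ nat_of_num e)"
proof (induction p x e arbitrary: m rule: pow_mod.induct)
  case (2 p x n)
  have "represents p (pow_mod p (mult_mod p x x) n) ((m * m) ^ nat_of_num n)"
    by (rule 2) (use 2 in \<open>simp add: represents_mult_mod\<close>)
  then show ?case by (simp add: power_mult_distrib power_add)
next
  case (3 p x n)
  have "represents p (pow_mod p (mult_mod p x x) n) ((m * m) ^ nat_of_num n)"
    by (rule 3) (use 3 in \<open>simp add: represents_mult_mod\<close>)
  from represents_mult_mod[OF 3(2) this] show ?case by (simp add: power_mult_distrib power_add)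
qed auto

section \<open>The trie of squares\<close>

text \<open>The invariant is \<open>s \<equiv> x\<^sup>2\<close> and \<open>d = 2 * x + 1\<close>, so that adding \<open>d\<close> to \<open>s\<close> gives the next square.\<close>

function squares_from :: "num \<Rightarrow> num \<Rightarrow> num \<Rightarrow> trie \<Rightarrow> trie" where
  "squares_from p s d T = (if p < d then trie_insert s T
     else squares_from p (add_mod p s d) (Num.inc (Num.inc d)) (trie_insert s T))"
  by auto
termination
  by (relation "measure (\<lambda>(p, s, d, T). nat_of_num p + 1 - nat_of_num d)")
     (auto simp: nat_of_num_inc less_num_def less_eq_num_def)
declare squares_from.simps [simp del]

lemma squares_from_mono: "trie_member k T \<Longrightarrow> trie_member k (squares_from p s d T)"
proof (induction p s d T rule: squares_from.induct)
  case (1 p s d T)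
  then show ?case by (subst squares_from.simps) (simp add: trie_member_insert)
qed

lemma squares_from_complete:
  assumes "represents p s (x\<^sup>2)" "nat_of_num d = 2 * x + 1" "x \<le> y" "2 * y \<le> nat_of_num p"
  shows "\<exists>k. trie_member k (squares_from p s d T) \<and> represents p k (y\<^sup>2)"
  using assms
proof (induction p s d T arbitrary: x rule: squares_from.induct)
  case (1 p s d T)
  show ?case
  proof (cases "x = y")
    case True
    have "trie_member s (squares_from p s d T)"
      by (subst squares_from.simps) (simp add: squares_from_mono trie_member_insert_same)
    then show ?thesis using 1 True by auto
  next
    case False
    \<comment> \<open>As \<open>x < y\<close>, the increment \<open>d = 2 * x + 1\<close> is below
      \<open>2 * y\<close>, so the loop has not ended yet.\<close>
    then have le: "nat_of_num d \<le> nat_of_num p" using 1 by simp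
    then have nl: "\<not> p < d" by (simp add: less_num_def)
    have "represents p (add_mod p s d) (x\<^sup>2 + nat_of_num d)"
      using 1(2) le by (intro represents_add_mod) (auto simp: represents_def)
    then have "represents p (add_mod p s d) ((Suc x)\<^sup>2)"
      using 1(3) by (simp add: power2_eq_square mult_2 add_ac)
    then have "\<exists>k. trie_member k (squares_from p (add_mod p s d) (Num.inc (Num.inc d)) (trie_insert s T))
        \<and> represents p k (y\<^sup>2)"
      using 1(3-5) False nl by (intro 1(1)[of "Suc x"]) (auto simp: nat_of_num_inc)
    then show ?thesis using nl by (subst squares_from.simps) simp
  qed
qed

definition num_of_int :: "int \<Rightarrow> num" where
  "num_of_int z = num_of_nat (nat z)"

text \<open>A positive literal of type \<open>int\<close> evaluates to \<open>Int.Pos k\<close>, so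
  the conversion to \<open>num\<close> only strips a constructor.\<close>

lemma num_of_int_code [code]: "num_of_int (Int.Pos k) = k"
  by (simp add: num_of_int_def Int.Pos_def flip: nat_of_num_numeral)
     (simp add: nat_of_num_inverse)

lemma nat_of_num_of_int: "z > 0 \<Longrightarrow> nat_of_num (num_of_int z) = nat z"
  by (simp add: num_of_int_def num_of_nat_inverse)

text \<open>The class of 0, represented by \<open>p\<close>, is inserted separately; the loop starts
  at 1, where the gap to the next square is 3.\<close>

definition squares :: "num \<Rightarrow> trie" where
  "squares p = squares_from p num.One (num_of_int 3) (trie_insert p Tip)"

text \<open>A number and its negative have the same square, so some root is at most half of the
  modulus, and \<open>squares_from\<close> reaches it.\<close>

lemma squares_complete:
  assumes "represents p k (a\<^sup>2)"
  shows "trie_member k (squares p)"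
proof -
  define P where "P = nat_of_num p"
  have P: "P > 0" by (simp add: P_def nat_of_num_pos)
  obtain y where y: "[y\<^sup>2 = a\<^sup>2] (mod P)" "2 * y \<le> P"
  proof (cases "2 * (a mod P) \<le> P")
    case True
    then show ?thesis using that[of "a mod P"] by (simp add: cong_def power_mod)
  next
    case False
    define z where "z = P - a mod P"
    have "int z = int P - int (a mod P)"
      using P by (simp add: z_def of_nat_diff less_imp_le)
    moreover have "[int P - int (a mod P) = 0 - int a] (mod int P)"
      by (intro cong_diff) (auto simp: cong_def zmod_int)
    ultimately have "[int z = - int a] (mod int P)" by simp
    then have "[(int z)\<^sup>2 = (- int a)\<^sup>2] (mod int P)" by (rule cong_pow)
    then have "[z\<^sup>2 = a\<^sup>2] (mod P)" by (simp flip: cong_int_iff)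
    then show ?thesis using that[of z] False by (auto simp: z_def)
  qed
  have "\<exists>k. trie_member k (squares p) \<and> represents p k (y\<^sup>2)"
  proof (cases "y = 0")
    case True
    have "trie_member p (squares p)"
      by (simp add: squares_def squares_from_mono trie_member_insert_same)
    then show ?thesis using True by (auto simp: represents_def cong_def)
  next
    case False
    then show ?thesis unfolding squares_def
      by (intro squares_from_complete[where x = 1])
         (use y P_def represents_One in \<open>auto simp: nat_of_num_of_int\<close>)
  qed
  then show ?thesis
    using y(1) assms represents_unique represents_cong unfolding P_def by metis
qed

fun powers :: "num \<Rightarrow> num \<Rightarrow> num \<Rightarrow> nat \<Rightarrow> num list" where
  "powers p w x 0 = []"
| "powers p w x (Suc n) = x # powers p w (mult_mod p x w) n"

lemma length_powers [simp]: "length (powers p w x n) = n"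
  by (induction n arbitrary: x) auto

lemma represents_powers:
  assumes "represents p w W"
  shows "represents p x m \<Longrightarrow> u < n \<Longrightarrow> represents p (powers p w x n ! u) (m * W ^ u)"
proof (induction n arbitrary: x m u)
  case (Suc n)
  show ?case
  proof (cases u)
    case (Suc u')
    have "represents p (powers p w (mult_mod p x w) n ! u') (m * W * W ^ u')"
      by (rule Suc.IH) (use Suc Suc.prems assms represents_mult_mod in auto)
    then show ?thesis using Suc by (simp add: mult_ac)
  qed (use Suc in auto)
qed auto

section \<open>Filtering the triples of offsets\<close>

text \<open>
  A list of triples, grouped by their first two components. A flat list would make evaluation
  quadratic in its length, as the simplifier traverses the whole tail at every step.
\<close>

type_synonym candidates = "(nat \<times> (nat \<times> nat list) list) list"

fun cons_nonempty :: "'a \<Rightarrow> 'b list \<Rightarrow> ('a \<times> 'b list) list \<Rightarrow> ('a \<times> 'b list) list" where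
  "cons_nonempty x [] zs = zs"
| "cons_nonempty x (y # ys) zs = (x, y # ys) # zs"

lemma cons_nonempty_iff:
  "(\<exists>ys'. (x', ys') \<in> set (cons_nonempty x ys zs) \<and> P ys') \<longleftrightarrow>
    (x' = x \<and> ys \<noteq> [] \<and> P ys) \<or> (\<exists>ys'. (x', ys') \<in> set zs \<and> P ys')"
  by (cases ys) auto

fun select1 :: "num \<Rightarrow> trie \<Rightarrow> num list \<Rightarrow> num \<Rightarrow> nat list \<Rightarrow> nat list" where
  "select1 p T C x [] = []"
| "select1 p T C x (w # ws) =
    (if trie_member (add_mod p x (C ! w)) T then w # select1 p T C x ws else select1 p T C x ws)"

fun select2 where
  "select2 p T B C x [] = []"
| "select2 p T B C x ((v, ws) # vs) =
    cons_nonempty v (select1 p T C (add_mod p x (B ! v)) ws) (select2 p T B C x vs)"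

fun select3 where
  "select3 p T A B C [] = []"
| "select3 p T A B C ((u, vs) # us) =
    cons_nonempty u (select2 p T B C (A ! u) vs) (select3 p T A B C us)"

text \<open>With \<open>g\<close> for 10 and \<open>h\<close> for \<open>10 ^ L\<close>, the tables
  list the powers of 10 with exponents \<open>r + L * u\<close>. The constant \<open>c\<close>, for
  121, is added once to the third table rather than for every triple.\<close>

fun select4 where
  "select4 p T c g h q [] = []"
| "select4 p T c g h q (((r, s, t), us) # xs) = cons_nonempty (r, s, t)
     (select3 p T (powers p h (pow_mod p g r) q) (powers p h (pow_mod p g s) q)
       (map (add_mod p c) (powers p h (pow_mod p g t) q)) us)
     (select4 p T c g h q xs)"

definition candidate :: "nat \<Rightarrow> nat \<Rightarrow> nat \<Rightarrow> candidates \<Rightarrow> bool" where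
  "candidate u v w us \<longleftrightarrow> (\<exists>vs. (u, vs) \<in> set us \<and> (\<exists>ws. (v, ws) \<in> set vs \<and> w \<in> set ws))"

lemma select1_complete:
  "w \<in> set ws \<Longrightarrow> trie_member (add_mod p x (C ! w)) T \<Longrightarrow> w \<in> set (select1 p T C x ws)"
  by (induction ws) auto

lemma select2_complete:
  assumes "trie_member (add_mod p (add_mod p x (B ! v)) (C ! w)) T"
  shows "(v, ws) \<in> set vs \<Longrightarrow> w \<in> set ws \<Longrightarrow>
    \<exists>ws'. (v, ws') \<in> set (select2 p T B C x vs) \<and> w \<in> set ws'"
proof (induction vs)
  case (Cons y vs)
  have "select1 p T C (add_mod p x (B ! v)) ws \<noteq> []" "w \<in> set (select1 p T C (add_mod p x (B ! v)) ws)"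
    using select1_complete[OF Cons.prems(2) assms] by auto
  then show ?case using Cons by (cases y) (auto simp: cons_nonempty_iff)
qed auto

lemma select3_complete:
  assumes "trie_member (add_mod p (add_mod p (A ! u) (B ! v)) (C ! w)) T"
  shows "candidate u v w us \<Longrightarrow> candidate u v w (select3 p T A B C us)"
proof (induction us)
  case (Cons y us)
  obtain u' vs' where y: "y = (u', vs')" by fastforce
  show ?case
  proof (cases "candidate u v w us")
    case True
    then show ?thesis using Cons.IH y by (simp add: candidate_def cons_nonempty_iff)
  next
    case False
    then obtain ws where ws: "u = u'" "(v, ws) \<in> set vs'" "w \<in> set ws"
      using Cons.prems y by (auto simp: candidate_def)
    from select2_complete[where x = "A ! u" and B = B and C = C, OF assms ws(2,3)] obtain ws'
      where "(v, ws') \<in> set (select2 p T B C (A ! u) vs')" "w \<in> set ws'" by blast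
    then show ?thesis using y ws(1) by (auto simp: candidate_def cons_nonempty_iff)
  qed
qed (simp add: candidate_def)

section \<open>Completeness of the sieve\<close>

type_synonym state = "((num \<times> num \<times> num) \<times> candidates) list"

definition admits :: "nat \<Rightarrow> nat \<Rightarrow> nat \<Rightarrow> nat \<Rightarrow> nat \<Rightarrow> num \<times> num \<times> num \<Rightarrow> candidates \<Rightarrow> bool" where
  "admits L M i j k = (\<lambda>(r, s, t) us. \<exists>u v w. candidate u v w us \<and> u < M \<and> v < M \<and> w < M \<and>
     [i = nat_of_num r + L * u] (mod L * M) \<and> [j = nat_of_num s + L * v] (mod L * M) \<and>
     [k = nat_of_num t + L * w] (mod L * M))"

definition possible :: "nat \<Rightarrow> nat \<Rightarrow> state \<Rightarrow> nat \<Rightarrow> nat \<Rightarrow> nat \<Rightarrow> bool" where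
  "possible L M st i j k \<longleftrightarrow> (\<exists>(b, us) \<in> set st. admits L M i j k b us)"

lemma possible_Nil: "\<not> possible L M [] i j k"
  by (simp add: possible_def)

lemma possible_Cons:
  "possible L M ((b, us) # st) i j k \<longleftrightarrow> admits L M i j k b us \<or> possible L M st i j k"
  by (simp add: possible_def)

lemma possible_cons_nonempty:
  "possible L M (cons_nonempty b us st) i j k \<longleftrightarrow> admits L M i j k b us \<or> possible L M st i j k"
proof (cases us)
  case Nil
  then show ?thesis by (simp add: admits_def candidate_def split: prod.splits)
qed (simp add: possible_Cons)

lemma cong_pow_exponent:
  fixes g P M :: nat
  assumes "[g ^ M = 1] (mod P)" "[i = j] (mod M)"
  shows "[g ^ i = g ^ j] (mod P)"
proof -
  have *: "[g ^ n = g ^ (n mod M)] (mod P)" for n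
  proof -
    have "g ^ n = (g ^ M) ^ (n div M) * g ^ (n mod M)"
      by (simp flip: power_mult power_add)
    moreover have "[(g ^ M) ^ (n div M) * g ^ (n mod M) = 1 ^ (n div M) * g ^ (n mod M)] (mod P)"
      by (intro cong_mult cong_pow assms cong_refl)
    ultimately show ?thesis by simp
  qed
  show ?thesis using *[of i] *[of j] assms(2) by (metis cong_def)
qed

text \<open>The table entries belonging to a solution represent \<open>10 ^ i\<close>,
  \<open>10 ^ j\<close> and \<open>121 + 10 ^ k\<close>, so their sum represents a square and is
  found in the trie.\<close>

lemma select4_complete:
  fixes a :: nat
  assumes sol: "121 + 10 ^ i + 10 ^ j + 10 ^ k = a\<^sup>2"
    and c: "represents p c 121" and g: "represents p g 10"
    and h: "represents p h (10 ^ L)"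
    and per: "[10 ^ (L * M) = (1::nat)] (mod nat_of_num p)"
  shows "possible L M st i j k \<Longrightarrow> possible L M (select4 p (squares p) c g h M st) i j k"
proof (induction st)
  case (Cons x st)
  obtain r s t us where x: "x = ((r, s, t), us)" by (metis surj_pair)
  define A where "A = powers p h (pow_mod p g r) M"
  define B where "B = powers p h (pow_mod p g s) M"
  define C where "C = map (add_mod p c) (powers p h (pow_mod p g t) M)"
  have entry: "represents p (powers p h (pow_mod p g r) M ! u) (10 ^ i)"
    if "u < M" "[i = nat_of_num r + L * u] (mod L * M)" for r u i
  proof -
    have "represents p (powers p h (pow_mod p g r) M ! u) (10 ^ nat_of_num r * (10 ^ L) ^ u)"
      using that by (intro represents_powers h represents_pow_mod g)
    moreover have "[10 ^ nat_of_num r * (10 ^ L) ^ u = 10 ^ i] (mod nat_of_num p)"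
      using cong_pow_exponent[OF per cong_sym[OF that(2)]] by (simp add: power_add power_mult)
    ultimately show ?thesis by (rule represents_cong)
  qed
  have head: "admits L M i j k (r, s, t) (select3 p (squares p) A B C us)"
    if adm: "admits L M i j k (r, s, t) us"
  proof -
    obtain u v w where uvw: "candidate u v w us" "u < M" "v < M" "w < M"
      "[i = nat_of_num r + L * u] (mod L * M)" "[j = nat_of_num s + L * v] (mod L * M)"
      "[k = nat_of_num t + L * w] (mod L * M)"
      using adm unfolding admits_def prod.case by blast
    have "represents p (C ! w) (121 + 10 ^ k)"
      using represents_add_mod[OF c entry[OF uvw(4,7)]] uvw(4) by (simp add: C_def)
    then have "represents p (add_mod p (add_mod p (A ! u) (B ! v)) (C ! w)) (10 ^ i + 10 ^ j + (121 + 10 ^ k))"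
      unfolding A_def B_def by (intro represents_add_mod entry uvw)
    also have "10 ^ i + 10 ^ j + (121 + 10 ^ k) = a\<^sup>2" using sol by simp
    finally have "trie_member (add_mod p (add_mod p (A ! u) (B ! v)) (C ! w)) (squares p)"
      by (rule squares_complete)
    from select3_complete[OF this uvw(1)] show ?thesis
      using uvw unfolding admits_def prod.case by blast
  qed
  show ?case
    using Cons head unfolding x select4.simps possible_Cons possible_cons_nonempty
    by (auto simp flip: A_def B_def C_def)
qed (simp add: possible_Nil)

text \<open>The test ensures that powers of 10 modulo \<open>p\<close> depend only on the exponent
  modulo \<open>L * q\<close>. If it fails, the state is passed on unchanged, so no solution is lost
  for any \<open>p\<close>.\<close>

definition sieve :: "num \<Rightarrow> num \<Rightarrow> num \<Rightarrow> state \<Rightarrow> state" where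
  "sieve L q p st =
    (if pow_mod p (mult_mod p num.One (num_of_int 10)) (L * q) = num.One
     then select4 p (squares p) (mult_mod p num.One (num_of_int 121)) (mult_mod p num.One (num_of_int 10))
       (pow_mod p (mult_mod p num.One (num_of_int 10)) L) (nat_of_num q) st
     else st)"

lemma sieve_complete:
  fixes a :: nat
  assumes sol: "121 + 10 ^ i + 10 ^ j + 10 ^ k = a\<^sup>2"
    and "possible (nat_of_num L) (nat_of_num q) st i j k"
  shows "possible (nat_of_num L) (nat_of_num q) (sieve L q p st) i j k"
proof -
  have const: "represents p (mult_mod p num.One (num_of_int z)) (nat z)" if "z > 0" for z
    using represents_mult_num[OF represents_One, of p "num_of_int z"] that by (simp add: nat_of_num_of_int)
  define g where "g = mult_mod p num.One (num_of_int 10)"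
  have g: "represents p g 10" using const[of 10] by (simp add: g_def)
  show ?thesis
  proof (cases "pow_mod p g (L * q) = num.One")
    case True
    have "[10 ^ (nat_of_num L * nat_of_num q) = (1::nat)] (mod nat_of_num p)"
      using represents_pow_mod[OF g, of "L * q"] True
      by (simp add: represents_def nat_of_num_mult cong_sym_eq)
    from select4_complete[OF sol _ g represents_pow_mod[OF g] this assms(2)]
    show ?thesis using const[of 121] True by (simp add: sieve_def g_def)
  qed (use assms in \<open>simp add: sieve_def g_def\<close>)
qed

section \<open>Refinement of residue triples\<close>

definition all_candidates :: "nat \<Rightarrow> candidates" where
  "all_candidates M = map (\<lambda>u. (u, map (\<lambda>v. (v, [0..<M])) [0..<M])) [0..<M]"

text \<open>Repeated addition, since the offset is a natural number that may be 0, which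
  \<open>num\<close> cannot express.\<close>

fun add_times :: "num \<Rightarrow> num \<Rightarrow> nat \<Rightarrow> num" where
  "add_times L r 0 = r"
| "add_times L r (Suc n) = add_times L (r + L) n"

lemma nat_of_num_add_times: "nat_of_num (add_times L r n) = nat_of_num r + nat_of_num L * n"
  by (induction L r n rule: add_times.induct) (auto simp: nat_of_num_add)

definition flatten :: "num \<Rightarrow> state \<Rightarrow> (num \<times> num \<times> num) list" where
  "flatten L st = [(add_times L r u, add_times L s v, add_times L t w).
     ((r, s, t), us) \<leftarrow> st, (u, vs) \<leftarrow> us, (v, ws) \<leftarrow> vs, w \<leftarrow> ws]"

text \<open>Each triple modulo \<open>L\<close> is lifted to all \<open>q^3\<close> triples modulo
  \<open>L * q\<close> above it, which are then filtered by every modulus in \<open>ps\<close>.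
  Integers as input and output let each stage be stated with plain literals.\<close>

definition refine :: "int \<Rightarrow> int \<Rightarrow> int list \<Rightarrow> (int \<times> int \<times> int) list \<Rightarrow> (int \<times> int \<times> int) list" where
  "refine L q ps rs =
    map (\<lambda>(r, s, t). (numeral r, numeral s, numeral t))
      (flatten (num_of_int L)
        (fold (\<lambda>p. sieve (num_of_int L) (num_of_int q) (num_of_int p)) ps
          (map (\<lambda>(r, s, t). ((num_of_int r, num_of_int s, num_of_int t),
             all_candidates (nat_of_num (num_of_int q)))) rs)))"

definition residue_triple :: "int \<Rightarrow> (int \<times> int \<times> int) list \<Rightarrow> nat \<Rightarrow> nat \<Rightarrow> nat \<Rightarrow> bool" where
  "residue_triple L rs i j k \<longleftrightarrow> (\<exists>r s t. (r, s, t) \<in> set rs \<and> r > 0 \<and> s > 0 \<and> t > 0 \<and>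
     [int i = r] (mod L) \<and> [int j = s] (mod L) \<and> [int k = t] (mod L))"

lemma cong_lift_nat:
  fixes i r L M :: nat
  assumes "[i = r] (mod L)" "M > 0"
  shows "\<exists>u<M. [i = r + L * u] (mod L * M)"
proof (cases "L = 0")
  case False
  \<comment> \<open>Adding a multiple of \<open>L * M\<close> to \<open>i\<close> makes it at least
    \<open>r\<close>, so that the quotient is a natural number.\<close>
  then have le: "r \<le> i + L * M * r" using assms(2) by (simp add: trans_le_add2)
  have "[i + L * M * r = r] (mod L)"
    using assms(1) by (simp add: cong_def mult.assoc)
  then obtain c where c: "i + L * M * r = c * L + r"
    using cong_le_nat[OF le] by blast
  have "[i = i + L * M * r] (mod L * M)" by (simp add: cong_def)
  also have "i + L * M * r = r + L * c" using c by simp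
  also have "[r + L * c = r + L * (c mod M)] (mod L * M)"
    by (intro cong_add cong_refl) (simp add: cong_def flip: mult_mod_right)
  finally show ?thesis using assms(2) by (intro exI[of _ "c mod M"]) simp
qed (use assms in auto)

lemma refine_complete:
  fixes a :: nat
  assumes sol: "121 + 10 ^ i + 10 ^ j + 10 ^ k = a\<^sup>2"
    and L: "L > 0" and q: "q > 0"
    and rs: "residue_triple L rs i j k"
  shows "residue_triple (L * q) (refine L q ps rs) i j k"
proof -
  define l where "l = nat_of_num (num_of_int L)"
  define m where "m = nat_of_num (num_of_int q)"
  have l: "int l = L" and m: "int m = q" "m > 0"
    using L q by (auto simp: l_def m_def nat_of_num_of_int)
  define st where "st = map (\<lambda>(r, s, t). ((num_of_int r, num_of_int s, num_of_int t), all_candidates m)) rs"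
  from rs obtain r s t where rst: "(r, s, t) \<in> set rs" "r > 0" "s > 0" "t > 0"
    "[int i = r] (mod L)" "[int j = s] (mod L)" "[int k = t] (mod L)"
    unfolding residue_triple_def by blast
  have lift: "\<exists>u<m. [i = nat_of_num (num_of_int r) + l * u] (mod l * m)"
    if "r > 0" "[int i = r] (mod L)" for r i
  proof (rule cong_lift_nat[OF _ m(2)])
    show "[i = nat_of_num (num_of_int r)] (mod l)"
      using that l by (simp add: nat_of_num_of_int flip: cong_int_iff)
  qed
  from lift[OF rst(2,5)] lift[OF rst(3,6)] lift[OF rst(4,7)] obtain u v w where uvw:
    "u < m" "[i = nat_of_num (num_of_int r) + l * u] (mod l * m)"
    "v < m" "[j = nat_of_num (num_of_int s) + l * v] (mod l * m)"
    "w < m" "[k = nat_of_num (num_of_int t) + l * w] (mod l * m)" by blast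
  have "candidate u v w (all_candidates m)"
    unfolding candidate_def all_candidates_def using uvw
    by (intro exI[of _ "map (\<lambda>v. (v, [0..<m])) [0..<m]"] exI[of _ "[0..<m]"] conjI) auto
  moreover have "((num_of_int r, num_of_int s, num_of_int t), all_candidates m) \<in> set st"
    using rst(1) by (force simp: st_def)
  moreover have "admits l m i j k (num_of_int r, num_of_int s, num_of_int t) (all_candidates m)"
    if "candidate u v w (all_candidates m)"
    unfolding admits_def prod.case using that uvw by blast
  ultimately have "possible l m st i j k"
    unfolding possible_def by blast
  then have "possible l m (fold (\<lambda>p. sieve (num_of_int L) (num_of_int q) (num_of_int p)) ps st) i j k"
    unfolding l_def m_def
    by (induction ps arbitrary: st) (auto intro: sieve_complete[OF sol])
  then obtain b us where b:
    "(b, us) \<in> set (fold (\<lambda>p. sieve (num_of_int L) (num_of_int q) (num_of_int p)) ps st)"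
    "admits l m i j k b us"
    unfolding possible_def by blast
  obtain r s t where rst': "b = (r, s, t)" by (metis surj_pair)
  obtain u v w where fin: "candidate u v w us"
    "[i = nat_of_num r + l * u] (mod l * m)" "[j = nat_of_num s + l * v] (mod l * m)"
    "[k = nat_of_num t + l * w] (mod l * m)"
    using b(2) unfolding rst' admits_def prod.case by blast
  let ?f = "add_times (num_of_int L)"
  have "(?f r u, ?f s v, ?f t w) \<in> set (flatten (num_of_int L)
      (fold (\<lambda>p. sieve (num_of_int L) (num_of_int q) (num_of_int p)) ps st))"
  proof -
    obtain vs ws where vs: "(u, vs) \<in> set us" "(v, ws) \<in> set vs" "w \<in> set ws"
      using fin(1) unfolding candidate_def by blast
    show ?thesis
      unfolding flatten_def set_concat set_map
      by (rule UnionI[OF imageI[OF imageI[OF b(1)[unfolded rst']]]], simp, rule bexI[OF _ vs(1)], simp,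
          rule bexI[OF _ vs(2)], use vs(3) in simp)
  qed
  then have mem: "(numeral (?f r u), numeral (?f s v), numeral (?f t w)) \<in> set (refine L q ps rs)"
    unfolding refine_def st_def m_def set_map by (rule rev_image_eqI) simp
  have cg: "[int i = numeral (?f r u)] (mod L * q)"
    if "[i = nat_of_num r + l * u] (mod l * m)" for i r u
  proof -
    have "(numeral (?f r u) :: int) = int (nat_of_num (?f r u))"
      by (simp add: nat_of_num_numeral)
    also have "\<dots> = int (nat_of_num r + l * u)"
      by (simp only: nat_of_num_add_times l_def)
    finally have "(numeral (?f r u) :: int) = int (nat_of_num r + l * u)" .
    moreover have "L * q = int (l * m)" by (simp add: l m)
    ultimately show ?thesis using that by (simp only: cong_int_iff)
  qed
  show ?thesis
    unfolding residue_triple_def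
    using mem cg[OF fin(2)] cg[OF fin(3)] cg[OF fin(4)] zero_less_numeral by blast
qed

section \<open>The exceptional residue class\<close>

definition residues_6 :: "(int \<times> int \<times> int) list" where
  "residues_6 = [(2, 2, 6), (2, 3, 6), (2, 4, 6), (4, 4, 4), (5, 6, 6)]"

definition residues_30 :: "(int \<times> int \<times> int) list" where
  "residues_30 = [(14, 21, 18), (2, 16, 6), (2, 28, 30), (8, 22, 30), (8, 28, 18), (20, 10, 30),
    (20, 28, 18)]"

definition residues_60 :: "(int \<times> int \<times> int) list" where
  "residues_60 = [(2, 16, 6), (2, 46, 36), (32, 46, 6), (2, 28, 30), (2, 28, 60), (2, 58, 30), (2, 58, 60),
    (32, 28, 60), (32, 58, 30), (8, 52, 60), (38, 22, 30), (38, 22, 60), (38, 28, 18),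
    (38, 58, 48), (20, 40, 60)]"

definition residues_420 :: "(int \<times> int \<times> int) list" where
  "residues_420 = [(2, 166, 336), (2, 418, 420), (212, 208, 420), (152, 58, 330), (212, 418, 210),
    (98, 418, 108)]"

definition residues_2100 :: "(int \<times> int \<times> int) list" where
  "residues_2100 = [(842, 586, 756), (842, 1846, 2016), (1262, 1006, 336), (1262, 1426, 1176),
    (1262, 1846, 1596), (1682, 166, 2016), (2, 2098, 2100), (1682, 838, 1680),
    (212, 1468, 2100), (632, 628, 1680), (1892, 1468, 420), (1412, 1318, 750),
    (1412, 1318, 1170), (1412, 1318, 2010), (1832, 478, 750), (212, 418, 1050),
    (212, 418, 1470), (632, 838, 630), (632, 1678, 630), (1892, 418, 1470), (98, 1678, 528),
    (1778, 418, 528)]"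

definition residues_4200 :: "(int \<times> int \<times> int) list" where
  "residues_4200 = [(2, 4198, 4200)]"

definition residues_71400 :: "(int \<times> int \<times> int) list" where
  "residues_71400 = [(2, 71398, 71400)]"

text \<open>The moduli are the primes other than 3 dividing \<open>10 ^ 6 - 1\<close>. The 19
  triples are the orderings of the five in \<open>residues_6\<close>.\<close>

lemma refine_6:
  "refine 1 6 [37, 11, 13, 7] [(1, 1, 1)] =
   [(2, 2, 6), (2, 3, 6), (2, 4, 6), (2, 6, 2), (2, 6, 3), (2, 6, 4), (3, 2, 6), (3, 6, 2),
    (4, 2, 6), (4, 4, 4), (4, 6, 2), (5, 6, 6), (6, 2, 2), (6, 2, 3), (6, 2, 4), (6, 3, 2),
    (6, 4, 2), (6, 5, 6), (6, 6, 5)]"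
  by code_simp

text \<open>Small factors keep the search short: each surviving triple has only \<open>q^3\<close>
  lifts, here 125, and most of them are removed before the next factor is taken.\<close>

lemma refine_30:
  "refine 6 5 [31, 271, 211, 241, 41, 2161] residues_6 = residues_30"
  by code_simp

lemma refine_60:
  "refine 30 2 [61, 101, 3541] residues_30 = residues_60"
  by code_simp

lemma refine_420:
  "refine 60 7 [29, 127, 239, 281, 71, 43, 421, 1933, 2689] residues_60 = residues_420"
  by code_simp

lemma refine_2100:
  "refine 420 5 [151, 251, 601, 701, 1051] residues_420 = residues_2100"
  by code_simp

lemma refine_4200:
  "refine 2100 2 [73, 401, 1201, 1601, 2801, 4201] residues_2100 = residues_4200"
  by code_simp

text \<open>The factor 17 makes the modulus a period of 10 modulo 23801, as
  \<open>71400 = 3 * 23800\<close>.\<close>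

lemma refine_71400:
  "refine 4200 17 [103, 409, 613, 953, 1021, 1361, 1429, 2381, 2551, 2857, 4013] residues_4200 = residues_71400"
  by code_simp

lemma refine_step:
  fixes a :: nat
  assumes "121 + 10 ^ i + 10 ^ j + 10 ^ k = a\<^sup>2" "refine L q ps rs = rs'"
    and "residue_triple L rs i j k" "L > 0" "q > 0" "M = L * q"
  shows "residue_triple M rs' i j k"
  using refine_complete[OF assms(1,4,5,3), of ps] unfolding assms(2,6) .

lemma residue_triple_Nil [simp]: "\<not> residue_triple L [] i j k"
  by (simp add: residue_triple_def)

lemma residue_triple_Cons [simp]:
  "residue_triple L ((r, s, t) # rs) i j k \<longleftrightarrow>
    (r > 0 \<and> s > 0 \<and> t > 0 \<and> [int i = r] (mod L) \<and> [int j = s] (mod L) \<and> [int k = t] (mod L)) \<or>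
    residue_triple L rs i j k"
  by (auto simp: residue_triple_def)

text \<open>The equation is symmetric in the exponents, so from here on one ordering of each triple
  is enough.\<close>

lemma square_residue_triple_sorted:
  fixes a :: nat
  assumes "121 + 10 ^ i + 10 ^ j + 10 ^ k = a\<^sup>2"
  defines "R \<equiv> residue_triple 6 residues_6"
  shows "R i j k \<or> R i k j \<or> R j i k \<or> R j k i \<or> R k i j \<or> R k j i"
proof -
  have "residue_triple 1 [(1, 1, 1)] i j k" by simp
  from refine_step[OF assms(1) refine_6 this, of 6]
  have "residue_triple 6 [(2, 2, 6), (2, 3, 6), (2, 4, 6), (2, 6, 2), (2, 6, 3), (2, 6, 4), (3, 2, 6),
      (3, 6, 2), (4, 2, 6), (4, 4, 4), (4, 6, 2), (5, 6, 6), (6, 2, 2), (6, 2, 3), (6, 2, 4), (6, 3, 2),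
      (6, 4, 2), (6, 5, 6), (6, 6, 5)] i j k"
    by simp
  then show ?thesis
    unfolding R_def residues_6_def residue_triple_Cons by (elim disjE conjE) simp_all
qed

lemma square_residue_triple:
  fixes a :: nat
  assumes sol: "121 + 10 ^ i + 10 ^ j + 10 ^ k = a\<^sup>2"
    and "residue_triple 6 residues_6 i j k"
  shows "residue_triple 71400 residues_71400 i j k"
proof -
  have "residue_triple 30 residues_30 i j k"
    by (rule refine_step[OF sol refine_30 assms(2)]) simp_all
  then have "residue_triple 60 residues_60 i j k"
    by (rule refine_step[OF sol refine_60]) simp_all
  then have "residue_triple 420 residues_420 i j k"
    by (rule refine_step[OF sol refine_420]) simp_all
  then have "residue_triple 2100 residues_2100 i j k"
    by (rule refine_step[OF sol refine_2100]) simp_all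
  then have "residue_triple 4200 residues_4200 i j k"
    by (rule refine_step[OF sol refine_4200]) simp_all
  then show ?thesis
    by (rule refine_step[OF sol refine_71400]) simp_all
qed

text \<open>The exponent is a variable \<open>E\<close> so that the huge power is never expanded;
  \<open>pow_mod\<close> computes it on residues.\<close>

lemma power_10_period:
  fixes E :: nat
  assumes "E = 71400"
  shows "[10 ^ E = 1] (mod (23801::nat))"
proof -
  define p g where "p = num_of_int 23801" and "g = num_of_int 10"
  have p: "nat_of_num p = 23801" by (simp add: p_def nat_of_num_of_int)
  have e: "nat_of_num (num_of_int 71400) = E" by (simp add: nat_of_num_of_int assms)
  have "represents p g 10" by (simp add: represents_def p g_def nat_of_num_of_int)
  then have "represents p (pow_mod p g (num_of_int 71400)) (10 ^ E)"
    using represents_pow_mod[of p g 10 "num_of_int 71400"] by (simp only: e)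
  moreover have "pow_mod p g (num_of_int 71400) = num.One"
    unfolding p_def g_def by code_simp
  ultimately have "represents p num.One (10 ^ E)" by (simp only:)
  then show ?thesis unfolding represents_def p by (simp add: cong_sym_eq)
qed

lemma dvd_if_residue_triple:
  fixes a :: nat
  assumes sol: "121 + 10 ^ i + 10 ^ j + 10 ^ k = a\<^sup>2"
    and "residue_triple 71400 residues_71400 i j k"
  shows "23801 dvd a\<^sup>2 + 16"
proof -
  define E :: nat where "E = 71400"
  have E: "int E = 71400" by (simp add: E_def)
  \<comment> \<open>Within the natural numbers, \<open>j + 2\<close> expresses that \<open>j\<close>
    is -2, and \<open>E\<close> represents the class of 0.\<close>
  have "[int i = int 2] (mod int E)" "[int (j + 2) = int E] (mod int E)" "[int k = int E] (mod int E)"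
    using assms(2) cong_add[of "int j" 71398 71400 2 2] by (simp_all add: E add.commute residues_71400_def)
  then have ijk: "[i = 2] (mod E)" "[j + 2 = E] (mod E)" "[k = E] (mod E)"
    by (simp_all only: cong_int_iff)
  note one = power_10_period[OF E_def]
  note pow = cong_pow_exponent[OF one]
  have i: "[10 ^ i = 100] (mod (23801::nat))" using pow[OF ijk(1)] by simp
  have k: "[10 ^ k = 1] (mod (23801::nat))" using pow[OF ijk(3)] one by (rule cong_trans)
  have "[10 ^ (j + 2) = 1] (mod (23801::nat))" using pow[OF ijk(2)] one by (rule cong_trans)
  then have j: "[100 * 10 ^ j = 1] (mod (23801::nat))" by (simp add: power_add mult.commute)
  \<comment> \<open>Multiplying by 100 turns the residue 1/100 of \<open>10 ^ j\<close> into 1; the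
    total is \<open>100 * 238 + 1 = 23801\<close>.\<close>
  have "[100 * (137 + 10 ^ i + 10 ^ k) + 100 * 10 ^ j = 100 * (137 + 100 + 1) + 1] (mod (23801::nat))"
    by (intro cong_add cong_mult cong_refl i j k)
  moreover have "100 * (137 + 10 ^ i + 10 ^ k) + 100 * 10 ^ j = 100 * (a\<^sup>2 + 16)"
    unfolding sol[symmetric] by (simp add: algebra_simps)
  moreover have "100 * (137 + 100 + 1) + 1 = (23801::nat)" by simp
  ultimately have "[100 * (a\<^sup>2 + 16) = 23801] (mod 23801)" by (simp only:)
  then have "23801 dvd 100 * (a\<^sup>2 + 16)" by (simp add: cong_def dvd_eq_mod_eq_0)
  \<comment> \<open>As \<open>23801 - 238 * 100 = 1\<close>, this combination cancels the factor
    100.\<close>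
  then have "23801 dvd 23801 * (a\<^sup>2 + 16) - 238 * (100 * (a\<^sup>2 + 16))"
    by (rule dvd_diff_nat[OF dvd_triv_left dvd_mult])
  moreover have "23801 * n - 238 * (100 * n) = n" for n :: nat by simp
  ultimately show ?thesis by (simp only:)
qed

lemma dvd_square_add_16:
  fixes a :: nat
  assumes "a\<^sup>2 = 121 + 10 ^ i + 10 ^ j + 10 ^ k"
  shows "23801 dvd a\<^sup>2 + 16"
proof -
  have *: "23801 dvd a\<^sup>2 + 16"
    if "121 + 10 ^ i + 10 ^ j + 10 ^ k = a\<^sup>2" "residue_triple 6 residues_6 i j k" for i j k
    using dvd_if_residue_triple[OF that(1) square_residue_triple[OF that]] .
  show ?thesis
    using square_residue_triple_sorted[of i j k a] *[of i j k] *[of i k j] *[of j i k] *[of j k i]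
      *[of k i j] *[of k j i] assms
    by (auto simp: add_ac)
qed

section \<open>The contradiction from \<open>b = 4\<close>\<close>

theorem proposition4p3:
  fixes x :: "nat \<Rightarrow> nat" and a b :: nat
  assumes "\<And>i. i \<in> {1..4} \<Longrightarrow> prime (x i)"
    and "a > 0" and "b > 0"
    and "x 1 + x 2 + x 3 + x 4 = a\<^sup>2"
    and "(\<Sum>i = 1..4. dgs (x i)) = b\<^sup>2"
    and "dgs (a\<^sup>2) + dgs (b\<^sup>2) = dgs (a\<^sup>2 + b\<^sup>2)"
    and "prime (a\<^sup>2 + b\<^sup>2)"
    and "\<exists>s>0. a\<^sup>2 + b\<^sup>2 = 4 * s + 1"
  shows "b \<noteq> 4"
proof
  assume "b = 4"
  note dsum = assms(5)[unfolded \<open>b = 4\<close>] and nocarry = assms(6)[unfolded \<open>b = 4\<close>]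
    and prime = assms(7)[unfolded \<open>b = 4\<close>]
  have dgs16: "dgs 16 = 7" by (simp add: dgs.simps)
  have "odd (a\<^sup>2 + 4\<^sup>2)"
    using prime prime_odd_nat[OF prime] by simp
  then have odd: "odd a" by simp
  \<comment> \<open>A prime ending in 0 would be equal to both 2 and 5.\<close>
  have unit: "1 \<le> x i mod 10" if "i \<in> {1..4}" for i
  proof (rule ccontr)
    assume "\<not> 1 \<le> x i mod 10"
    then have "10 dvd x i" by (simp add: dvd_eq_mod_eq_0)
    then have "2 dvd x i" "5 dvd x i" by (auto intro: dvd_trans[of _ 10])
    then show False using assms(1)[OF that] primes_dvd_imp_eq[of 2 "x i"] primes_dvd_imp_eq[of 5 "x i"] by auto
  qed
  have four: "(\<Sum>i = 1..4. f i) = f 1 + f 2 + f 3 + f (4::nat)" for f :: "nat \<Rightarrow> nat"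
    by (simp add: eval_nat_numeral)
  have dsum4: "dgs (x 1) + dgs (x 2) + dgs (x 3) + dgs (x 4) = 16"
    using dsum unfolding four by simp
  define Y where "Y i = x i div 10" for i
  define Z where "Z i = x i mod 10" for i
  have x: "x i = 10 * Y i + Z i" for i by (simp add: Y_def Z_def)
  have dgs_x: "dgs (x i) = dgs (Y i) + Z i" for i
    unfolding x[of i] by (rule dgs_digit) (simp add: Z_def)
  define U where "U = Z 1 + Z 2 + Z 3 + Z 4"
  define m where "m = Y 1 + Y 2 + Y 3 + Y 4"
  have sq: "a\<^sup>2 = 10 * m + U" using assms(4) x[of 1] x[of 2] x[of 3] x[of 4] by (simp add: m_def U_def)
  have UD: "U + (dgs (Y 1) + dgs (Y 2) + dgs (Y 3) + dgs (Y 4)) = 16"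
    using dsum4 by (simp add: U_def dgs_x)
  have mod9: "a\<^sup>2 mod 9 = 7"
  proof -
    have "a\<^sup>2 mod 9 = (dgs (x 1) + dgs (x 2) + dgs (x 3) + dgs (x 4)) mod 9"
      unfolding assms(4)[symmetric] by (intro mod_add_cong dgs_mod_9[symmetric])
    then show ?thesis unfolding dsum4 by simp
  qed
  define d where "d = a mod 10"
  have "odd d" using odd by (simp add: d_def dvd_mod_iff)
  moreover have "d < 10" by (simp add: d_def)
  then have "d \<in> {0, 1, 2, 3, 4, 5, 6, 7, 8, 9}" by auto
  moreover have "a\<^sup>2 mod 10 = d\<^sup>2 mod 10" by (simp add: d_def power_mod)
  ultimately have "a\<^sup>2 mod 10 \<in> {1, 5, 9}" by auto
  \<comment> \<open>If the last digit \<open>e\<close> is 5 or 9, adding 16 carries and leaves the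
    last digit \<open>e - 4\<close>, so the digit sum changes by at most 2 - 4, not by 7 as
    required.\<close>
  moreover have "a\<^sup>2 mod 10 < 5"
  proof (rule ccontr)
    assume "\<not> a\<^sup>2 mod 10 < 5"
    then have "a\<^sup>2 mod 10 = 5 \<or> a\<^sup>2 mod 10 = 9" using calculation by auto
    moreover obtain n e where n: "a\<^sup>2 = 10 * n + e" "e < 10" by (rule digitE[of "a\<^sup>2"])
    ultimately have e: "e = 5 \<or> e = 9" by simp
    then have "dgs (10 * (n + 2) + (e - 4)) = dgs (n + 2) + (e - 4)" by (intro dgs_digit) auto
    moreover have "a\<^sup>2 + 16 = 10 * (n + 2) + (e - 4)" using n(1) e by auto
    moreover have "dgs (n + 2) \<le> dgs n + 2"
      using dgs_Suc_le[of n] dgs_Suc_le[of "Suc n"] by simp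
    moreover have "dgs (a\<^sup>2) = dgs n + e" unfolding n(1) by (rule dgs_digit[OF n(2)])
    moreover have "dgs (a\<^sup>2) + 7 = dgs (a\<^sup>2 + 16)" using nocarry by (simp add: dgs16)
    ultimately show False using e by auto
  qed
  ultimately have unit1: "a\<^sup>2 mod 10 = 1" by auto
  have "U \<ge> 4" using unit[of 1] unit[of 2] unit[of 3] unit[of 4] by (simp add: U_def Z_def)
  moreover have "U \<le> 16" using UD by simp
  moreover have "U mod 10 = 1" using sq unit1 by simp
  then have "U = 10 * (U div 10) + 1" by (metis mult_div_mod_eq)
  then obtain t where "U = 10 * t + 1" by blast
  \<comment> \<open>11 is the only number from 4 to 16 that is 1 modulo 10.\<close>
  ultimately have U: "U = 11" by simp
  have "dgs m \<le> dgs (Y 1) + dgs (Y 2) + dgs (Y 3) + dgs (Y 4)"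
    unfolding m_def by (meson add_le_mono1 dgs_add_le order_trans)
  then have "dgs m \<le> 5" using UD U by simp
  then obtain i j k where "a\<^sup>2 = 121 + 10 ^ i + 10 ^ j + 10 ^ k"
    using square_digit_sum_7_cases[OF odd sq[unfolded U] _ mod9] by blast
  then have "23801 dvd a\<^sup>2 + 16" by (rule dvd_square_add_16)
  then have "a\<^sup>2 + 16 = 23801" using prime by (auto simp: prime_nat_iff)
  \<comment> \<open>\<open>23801 - 16\<close> ends in 5, but the square ends in 1.\<close>
  then show False using unit1 by simp
qed

end
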